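(* Let $k \ge 2$, let $L$ be the step 2 free-nilpotent Lie algebra with $k$ generators, and let $h_i$ ($1\le i\le k$), $h_{ij}$ ($1\le i<j\le k$) be the linear coordinates on $L^*$ described in the context. Let $M = (M_{ij}) \in \mathfrak{so}(k)$ be a real skew-symmetric $k\times k$ matrix, and consider the affine subspace $$S_M = \{ h_{ij} = M_{ij} \mid 1 \le i < j \le k \} \subset L^*.$$ For $a = (a_1,\dots,a_k)\in\mathbb{R}^k$ let $I_a = \sum_{i=1}^k a_i h_i$, regarded as a linear function on $L^*$. Then $$\bigl(\ \{ I_a, h_i \}|_{S_M} = 0 \ \text{ for all } i = 1, \dots, k\ \bigr) \iff a \in \ker M.$$
   Context: $L = L^{(1)}\oplus L^{(2)}$ is the real step 2 free-nilpotent Lie algebra with $k \ge 2$ generators: $L^{(1)}$ has basis $X_1,\dots,X_k$, $L^{(2)}$ has basis $X_{ij}$, $1\le i<j\le k$, with $[X_i,X_j]=X_{ij}$ for $1\le i<j\le k$ and all $X_{ij}$ central, so $\dim L = k(k+1)/2$. On the dual space $L^*$ define the linear functions $h_i(\lambda)=\langle\lambda,X_i\rangle$ and $h_{ij}(\lambda)=\langle\lambda,X_{ij}\rangle$; they are linear coordinates on $L^*$. For $i>j$ put $h_{ij}=-h_{ji}$, and $h_{ii}=0$. The bracket $\{\cdot,\cdot\}$ is the Lie–Poisson bracket on $L^*$, determined by $$\{h_i,h_j\}=h_{ij},\qquad \{h_{ij},h_l\}=\{h_{ij},h_{lm}\}=0 .$$ *)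

theory Defs
  imports "HOL-Analysis.Analysis"
begin

locale lie_algebra =
  fixes br :: "'a::real_vector \<Rightarrow> 'a \<Rightarrow> 'a"
  assumes bilinear_br: "bilinear br"
    and br_self: "br x x = 0"
    and jacobi: "br x (br y z) + br y (br z x) + br z (br x y) = 0"

text \<open>
  The generators are indexed by a finite linearly ordered type, so the number of generators is
  \<open>k = CARD('n)\<close>; the basis vector \<open>X\<^sub>i\<^sub>j\<close> is \<open>br (X i) (X j)\<close> for \<open>i < j\<close>. The first four
  assumptions say that the \<open>X\<^sub>i\<close> and the \<open>X\<^sub>i\<^sub>j\<close> (\<open>i < j\<close>) are pairwise distinct and form a basis.
  The inner product of the underlying type plays no role in the structure: it only provides
  a topology for differentiation on the dual.
\<close>
locale free_nilpotent_step2 = lie_algebra br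
  for br :: "'a::euclidean_space \<Rightarrow> 'a \<Rightarrow> 'a" +
  fixes X :: "'n::{finite,linorder} \<Rightarrow> 'a"
  assumes inj_X: "inj X"
    and inj_X2: "inj_on (\<lambda>(i, j). br (X i) (X j)) {(i, j). i < j}"
    and disjoint_X: "range X \<inter> {br (X i) (X j) | i j. i < j} = {}"
    and independent_X: "independent (range X \<union> {br (X i) (X j) | i j. i < j})"
    and span_X: "span (range X \<union> {br (X i) (X j) | i j. i < j}) = UNIV"
    and central_X: "i < j \<Longrightarrow> br (br (X i) (X j)) z = 0"

text \<open>The dual space is \<^typ>\<open>'a \<Rightarrow>\<^sub>L real\<close>; in finite dimension every functional is bounded.\<close>

definition h1 :: "('n \<Rightarrow> 'a::euclidean_space) \<Rightarrow> 'n \<Rightarrow> ('a \<Rightarrow>\<^sub>L real) \<Rightarrow> real" where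
  "h1 X i = (\<lambda>l. blinfun_apply l (X i))"

definition h2 :: "('a \<Rightarrow> 'a \<Rightarrow> 'a::euclidean_space) \<Rightarrow> ('n::linorder \<Rightarrow> 'a) \<Rightarrow> 'n \<Rightarrow> 'n
    \<Rightarrow> ('a \<Rightarrow>\<^sub>L real) \<Rightarrow> real" where
  "h2 br X i j = (\<lambda>l. if i < j then blinfun_apply l (br (X i) (X j))
     else if j < i then - blinfun_apply l (br (X j) (X i))
     else 0)"

text \<open>The differential of a function on the dual, identified with an element of the Lie algebra
  through the canonical isomorphism with the bidual. It is meaningful only where the function
  is differentiable.\<close>

definition differential :: "(('a::euclidean_space \<Rightarrow>\<^sub>L real) \<Rightarrow> real) \<Rightarrow> ('a \<Rightarrow>\<^sub>L real) \<Rightarrow> 'a" where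
  "differential f l = (THE x. (f has_derivative (\<lambda>m. blinfun_apply m x)) (at l))"

definition lie_poisson :: "('a \<Rightarrow> 'a \<Rightarrow> 'a::euclidean_space) \<Rightarrow> (('a \<Rightarrow>\<^sub>L real) \<Rightarrow> real)
    \<Rightarrow> (('a \<Rightarrow>\<^sub>L real) \<Rightarrow> real) \<Rightarrow> ('a \<Rightarrow>\<^sub>L real) \<Rightarrow> real" where
  "lie_poisson br f g = (\<lambda>l. blinfun_apply l (br (differential f l) (differential g l)))"

definition affine_slice :: "('a \<Rightarrow> 'a \<Rightarrow> 'a::euclidean_space) \<Rightarrow> ('n::{finite,linorder} \<Rightarrow> 'a)
    \<Rightarrow> real^'n::{finite,linorder}^'n::{finite,linorder} \<Rightarrow> ('a \<Rightarrow>\<^sub>L real) set" where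
  "affine_slice br X M = {l. \<forall>i j. i < j \<longrightarrow> h2 br X i j l = M $ i $ j}"

definition linear_integral :: "('n::finite \<Rightarrow> 'a::euclidean_space) \<Rightarrow> real^'n
    \<Rightarrow> ('a \<Rightarrow>\<^sub>L real) \<Rightarrow> real" where
  "linear_integral X a = (\<lambda>l. \<Sum>i\<in>UNIV. a $ i * h1 X i l)"

lemma differential_eqI:
  assumes "(f has_derivative (\<lambda>m. blinfun_apply m x)) (at l)"
  shows "differential f l = x"
  unfolding differential_def
proof (rule the_equality)
  fix y assume "(f has_derivative (\<lambda>m. blinfun_apply m y)) (at l)"
  from has_derivative_unique[OF this assms]
  have eq: "(\<lambda>m :: 'a \<Rightarrow>\<^sub>L real. blinfun_apply m y) = (\<lambda>m. blinfun_apply m x)" .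
  have "inner b y = inner b x" for b
    using fun_cong[OF eq, of "blinfun_inner_right b"] by simp
  then show "y = x" by (simp add: euclidean_eq_iff[of y x] inner_commute)
qed (rule assms)

lemma differential_evaluation: "differential (\<lambda>l. blinfun_apply l x) l = x"
  by (rule differential_eqI[OF bounded_linear_imp_has_derivative[OF blinfun.bounded_linear_left]])

text \<open>The bracket satisfies the relations that determine it on the linear coordinates.\<close>

context free_nilpotent_step2
begin

lemma br_anti: "br x y = - br y x"
proof -
  have "br x x + br y x + (br x y + br y y) = 0"
    using br_self[of "x + y"]
    unfolding bilinear_ladd[OF bilinear_br] bilinear_radd[OF bilinear_br] .
  then show ?thesis by (simp add: br_self add_eq_0_iff2)
qed

lemma h2_eq: "h2 br X i j = (\<lambda>l. blinfun_apply l (br (X i) (X j)))"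
proof -
  have "br (X i) (X j) = - br (X j) (X i)" by (rule br_anti)
  moreover have "i = j \<Longrightarrow> br (X i) (X j) = 0" by (simp add: br_self)
  ultimately show ?thesis
    by (auto simp: h2_def fun_eq_iff blinfun.minus_right blinfun.zero_right)
qed

lemma central_X': "br (br (X i) (X j)) z = 0"
proof (cases i j rule: linorder_cases)
  case greater
  then have "br (- br (X j) (X i)) z = 0"
    by (simp add: bilinear_lneg[OF bilinear_br] central_X)
  then show ?thesis by (metis br_anti)
qed (simp_all add: central_X br_self bilinear_lzero[OF bilinear_br])

lemma lie_poisson_coordinates:
  "lie_poisson br (h1 X i) (h1 X j) = h2 br X i j"
  "lie_poisson br (h2 br X i j) (h1 X l) = (\<lambda>_. 0)"
  "lie_poisson br (h2 br X i j) (h2 br X l m) = (\<lambda>_. 0)"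
proof -
  have d1: "differential (h1 X p) f = X p" for p f
    unfolding h1_def by (rule differential_evaluation)
  have d2: "differential (h2 br X p q) f = br (X p) (X q)" for p q f
    unfolding h2_eq by (rule differential_evaluation)
  show "lie_poisson br (h1 X i) (h1 X j) = h2 br X i j"
    unfolding lie_poisson_def d1 h2_eq ..
  show "lie_poisson br (h2 br X i j) (h1 X l) = (\<lambda>_. 0)"
    "lie_poisson br (h2 br X i j) (h2 br X l m) = (\<lambda>_. 0)"
    unfolding lie_poisson_def d1 d2 central_X' blinfun.zero_right by (rule refl)+
qed

end

text \<open>The structure exists on every Euclidean space of dimension \<open>k(k+1)/2\<close>.\<close>

lemma card_le_pairs: "card {(i::'n::{finite,linorder}, j). i \<le> j} = CARD('n) * (CARD('n) + 1) div 2"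
proof -
  let ?A = "{(i::'n, j). i \<le> j}" and ?B = "{(i::'n, j). j \<le> i}"
  have "?B = prod.swap ` ?A" by force
  then have 1: "card ?B = card ?A" by (simp add: card_image)
  have "?A \<inter> ?B = (\<lambda>i. (i, i)) ` UNIV" by auto
  then have 2: "card (?A \<inter> ?B) = CARD('n)" by (simp add: card_image inj_on_def)
  have "?A \<union> ?B = UNIV" by auto
  then have "card (?A \<union> ?B) = CARD('n) * CARD('n)"
    by (metis UNIV_Times_UNIV card_cartesian_product)
  with 1 2 have "2 * card ?A = CARD('n) * (CARD('n) + 1)"
    using card_Un_Int[of ?A ?B] by simp
  then show ?thesis by simp
qed

lemma free_nilpotent_step2_exists:
  assumes "DIM('a::euclidean_space) = CARD('n::{finite,linorder}) * (CARD('n) + 1) div 2"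
  shows "\<exists>(br :: 'a \<Rightarrow> 'a \<Rightarrow> 'a) (X :: 'n \<Rightarrow> 'a). free_nilpotent_step2 br X"
proof -
  let ?A = "{(i::'n, j). i \<le> j}" and ?P = "{(i::'n, j). i < j}"
  obtain b where b: "bij_betw b ?A (Basis :: 'a set)"
    using finite_same_card_bij[OF finite finite_Basis] assms card_le_pairs by metis
  have inj: "inj_on b ?A" and img: "b ` ?A = Basis"
    using b unfolding bij_betw_def by blast+
  have ib: "inner (b p) (b q) = (if p = q then 1 else 0)" if "p \<in> ?A" "q \<in> ?A" for p q
  proof -
    have "b p \<in> Basis" "b q \<in> Basis" using that img by blast+
    moreover have "b p = b q \<longleftrightarrow> p = q" using that inj by (metis inj_on_eq_iff)
    ultimately show ?thesis by (simp add: inner_Basis)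
  qed
  define X where "X = (\<lambda>i. b (i, i))"
  define br where "br = (\<lambda>x y. \<Sum>(p, q)\<in>?P.
    (inner x (X p) * inner y (X q) - inner x (X q) * inner y (X p)) *\<^sub>R b (p, q))"
  have XX: "inner (X i) (X j) = (if i = j then 1 else 0)" for i j
    unfolding X_def by (subst ib) auto
  have bX: "inner (b (p, q)) (X i) = 0" if "p < q" for p q i
    using that unfolding X_def by (subst ib) auto
  have brX: "br (X i) (X j) = b (i, j)" if "i < j" for i j
  proof -
    have "br (X i) (X j) = (\<Sum>r\<in>?P. if r = (i, j) then b r else 0)"
      unfolding br_def XX using that by (intro sum.cong) (auto split: if_splits)
    also have "\<dots> = b (i, j)" using that by simp
    finally show ?thesis .
  qed
  have brX0: "inner (br x y) (X i) = 0" for x y i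
    by (auto simp: br_def inner_sum_left bX intro!: sum.neutral)
  have nil: "br (br x y) z = 0" for x y z
    by (subst br_def) (simp add: brX0)
  have nil': "br z (br x y) = 0" for x y z
    by (subst br_def) (simp add: brX0)
  have P: "{br (X i) (X j) | i j. i < j} = b ` ?P"
    by (auto simp: brX image_iff) (metis brX)
  have R: "range X = b ` {(i, i) | i. True}"
    by (auto simp: X_def)
  have A: "?A = {(i, i) | i. True} \<union> ?P" by auto
  have B: "range X \<union> {br (X i) (X j) | i j. i < j} = Basis"
    unfolding P R by (metis A image_Un img)
  have "free_nilpotent_step2 br X"
  proof
    show "bilinear br"
      unfolding bilinear_def br_def
      by (auto intro!: linearI simp: inner_add_left algebra_simps sum.distrib scaleR_sum_right
          case_prod_unfold sum_subtractf)
    show "br x x = 0" for x by (simp add: br_def)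
    show "br x (br y z) + br y (br z x) + br z (br x y) = 0" for x y z by (simp add: nil')
    show "inj X" unfolding X_def by (rule injI) (use inj in \<open>auto dest!: inj_onD\<close>)
    show "inj_on (\<lambda>(i, j). br (X i) (X j)) {(i, j). i < j}"
    proof -
      have "inj_on b ?P" by (rule inj_on_subset[OF inj]) auto
      then show ?thesis by (auto simp: inj_on_def brX)
    qed
    show "range X \<inter> {br (X i) (X j) | i j. i < j} = {}"
      unfolding P R by (subst inj_on_image_Int[OF inj, symmetric]) auto
    show "independent (range X \<union> {br (X i) (X j) | i j. i < j})"
      unfolding B by (rule independent_Basis)
    show "span (range X \<union> {br (X i) (X j) | i j. i < j}) = UNIV"
      unfolding B by (rule span_Basis)
    show "br (br (X i) (X j)) z = 0" for i j z by (rule nil)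
  qed
  then show ?thesis by blast
qed

end

theory Submission
  imports Defs
begin

text \<open>
  On \<open>S\<^sub>M\<close> the function \<open>{I\<^sub>a, h\<^sub>i} = \<Sum>\<^sub>j a\<^sub>j h\<^sub>j\<^sub>i\<close> is constant, equal to
  \<open>\<Sum>\<^sub>j a\<^sub>j M\<^sub>j\<^sub>i = - (M a)\<^sub>i\<close> by skew symmetry. The vanishing on \<open>S\<^sub>M\<close> forces \<open>M a = 0\<close> because
  \<open>S\<^sub>M\<close> is not empty: the \<open>X\<^sub>i\<^sub>j\<close> are linearly independent, so a functional can be prescribed on them.
\<close>

text \<open>Being linear, \<open>linear_integral X a\<close> is evaluation at one fixed vector, and
  the bidual identification returns that vector at every point.\<close>

lemma differential_linear_integral:
  "differential (linear_integral X a) l = (\<Sum>i\<in>UNIV. a $ i *\<^sub>R X i)"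
proof -
  have "linear_integral X a = (\<lambda>l. blinfun_apply l (\<Sum>i\<in>UNIV. a $ i *\<^sub>R X i))"
    by (simp add: linear_integral_def h1_def blinfun.sum_right blinfun.scaleR_right)
  then show ?thesis by (simp add: differential_evaluation)
qed

lemma skew_entry:
  fixes M :: "real^'n^'n"
  assumes "transpose M = - M"
  shows "M $ i $ j = - M $ j $ i"
  using arg_cong[OF assms, of "\<lambda>A. A $ j $ i"] by (simp add: transpose_def)

context free_nilpotent_step2
begin

lemma lie_poisson_linear_integral_h1:
  "lie_poisson br (linear_integral X a) (h1 X i) l = (\<Sum>j\<in>UNIV. a $ j * h2 br X j i l)"
proof -
  have "differential (h1 X i) l = X i"
    unfolding h1_def by (rule differential_evaluation)
  moreover have "br (\<Sum>j\<in>UNIV. a $ j *\<^sub>R X j) (X i) = (\<Sum>j\<in>UNIV. a $ j *\<^sub>R br (X j) (X i))"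
    using linear_sum[of "\<lambda>x. br x (X i)" "\<lambda>j. a $ j *\<^sub>R X j" UNIV] bilinear_br
    by (simp add: bilinear_lmul[OF bilinear_br]) (simp add: bilinear_def)
  ultimately show ?thesis
    by (simp add: lie_poisson_def differential_linear_integral h2_eq
        blinfun.sum_right blinfun.scaleR_right)
qed

lemma affine_slice_nonempty: "affine_slice br X M \<noteq> {}"
proof -
  let ?P = "{(i, j). i < j}" and ?b = "\<lambda>(i, j). br (X i) (X j)"
  \<comment> \<open>Prescribed values are functions of vectors, so the index pair has to be
    recovered from the basis vector; \<open>inj_X2\<close> makes this unambiguous.\<close>
  define g where "g x = (case the_inv_into ?P ?b x of (i, j) \<Rightarrow> M $ i $ j)" for x
  have "independent (?b ` ?P)"
    by (rule independent_mono[OF independent_X]) auto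
  then obtain f :: "'a \<Rightarrow> real" where "linear f" and f: "\<forall>x\<in>?b ` ?P. f x = g x"
    using linear_independent_extend by blast
  \<comment> \<open>Finite dimension makes the linear extension bounded, hence a point of the
    dual.\<close>
  then have apply_f: "blinfun_apply (Blinfun f) = f"
    by (simp add: bounded_linear_Blinfun_apply linear_conv_bounded_linear)
  have "f (br (X i) (X j)) = M $ i $ j" if "i < j" for i j
  proof -
    have "(i, j) \<in> ?P" using that by simp
    then have "f (?b (i, j)) = g (?b (i, j))" "the_inv_into ?P ?b (?b (i, j)) = (i, j)"
      using f the_inv_into_f_f[OF inj_X2] by blast+
    then show ?thesis by (simp add: g_def)
  qed
  then have "Blinfun f \<in> affine_slice br X M"
    by (simp add: affine_slice_def h2_def apply_f)
  then show ?thesis by blast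
qed

text \<open>The slice constrains only pairs \<open>i < j\<close>. Both sides are skew in the
  indices, which settles \<open>i > j\<close> and forces zeros on the diagonal.\<close>

lemma h2_on_affine_slice:
  assumes "transpose M = - M" and "l \<in> affine_slice br X M"
  shows "h2 br X i j l = M $ i $ j"
proof (cases i j rule: linorder_cases)
  case less
  then show ?thesis using assms(2) by (simp add: affine_slice_def)
next
  case equal
  then show ?thesis using skew_entry[OF assms(1), of i i] by (simp add: h2_def)
next
  case greater
  then have "h2 br X i j l = - h2 br X j i l" by (auto simp: h2_def)
  also have "\<dots> = - M $ j $ i" using greater assms(2) by (simp add: affine_slice_def)
  finally show ?thesis using skew_entry[OF assms(1), of i j] by simp
qed

lemma lie_poisson_linear_integral_on_affine_slice:
  assumes "transpose M = - M" and "l \<in> affine_slice br X M"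
  shows "lie_poisson br (linear_integral X a) (h1 X i) l = - (M *v a) $ i"
proof -
  have "lie_poisson br (linear_integral X a) (h1 X i) l = (\<Sum>j\<in>UNIV. a $ j * M $ j $ i)"
    by (simp add: lie_poisson_linear_integral_h1 h2_on_affine_slice[OF assms])
  also have "\<dots> = (\<Sum>j\<in>UNIV. - (M $ i $ j * a $ j))"
    \<comment> \<open>Skew symmetry trades column \<open>i\<close> of \<open>M\<close> for row
      \<open>i\<close>, at the cost of the sign.\<close>
    by (intro sum.cong refl) (subst skew_entry[OF assms(1)], simp)
  finally show ?thesis by (simp add: matrix_vector_mult_def sum_negf)
qed

end

theorem lemma1:
  fixes br :: "'a::euclidean_space \<Rightarrow> 'a \<Rightarrow> 'a"
    and X :: "'n::{finite,linorder} \<Rightarrow> 'a"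
    and M :: "real^'n::{finite,linorder}^'n::{finite,linorder}"
    and a :: "real^'n::{finite,linorder}"
  assumes "CARD('n) \<ge> 2"
    and "free_nilpotent_step2 br X"
    and "transpose M = - M"
  shows "(\<forall>i. \<forall>l\<in>affine_slice br X M. lie_poisson br (linear_integral X a) (h1 X i) l = 0)
    \<longleftrightarrow> a \<in> {v. M *v v = 0}"
proof -
  interpret free_nilpotent_step2 br X by (rule assms(2))
  show ?thesis
    \<comment> \<open>The bracket does not depend on the point of the slice, so a single point
      yields every component of \<open>M *v a = 0\<close>.\<close>
    using affine_slice_nonempty[of M]
    by (auto simp: lie_poisson_linear_integral_on_affine_slice[OF assms(3)] vec_eq_iff)
qed

end
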